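(* Let $n\ge 2$ and let $\Omega\subset\mathbb{R}^n$ be an open set with nonempty boundary $\partial\Omega$ of class $C^1$. Let $x\in\Omega$. Then $x\in\Omega\setminus\overline{\Sigma}$ if and only if $\pi(x)$ is a singleton and $d(x)<\rho_*(\xi)$, where $\pi(x)=\{\xi\}$.
   Context: For an open set $\Omega\subset\mathbb{R}^n$ with nonempty boundary: $d(x):=\inf_{\xi\in\partial\Omega}|\xi-x|$ for $x\in\Omega$ (distance function); $\pi(x):=\{\xi\in\partial\Omega \mid d(x)=|\xi-x|\}$ (metric projection, a set); $\Sigma:=\{x\in\Omega\mid \pi(x)\text{ is not a singleton}\}$ (skeleton); $\overline{\Sigma}$ is the closure of $\Sigma$ in $\Omega$ (cut locus). $B^n_r(x)$ is the open ball of radius $r$ centered at $x$. For $\xi\in\partial\Omega$, an open ball $B^n_r(x)\subset\mathbb{R}^n$ ($r>0$) is a locally inner touching ball at $\xi$ if $\xi\in\partial B^n_r(x)$ and there is an open neighborhood $U$ of $\xi$ in $\mathbb{R}^n$ such that $B^n_r(x)\cap U\subset\Omega\cap U$. The inner radius of curvature $\rho:\partial\Omega\to[0,\infty]$ is $\rho(\xi):=\sup\{r>0\mid B^n_r(x)\text{ is a locally inner touching ball at }\xi\text{ for some }x\}$ if at least one locally inner touching ball at $\xi$ exists, and $\rho(\xi):=0$ otherwise. Its lower semicontinuous envelope is $\rho_*(\xi):=\lim_{r\downarrow0}\inf\{\rho(\eta)\mid\eta\in B^n_r(\xi)\cap\partial\Omega\}\in[0,\infty]$. "$\partial\Omega$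 is of class $C^1$" has the usual meaning: near each boundary point, after a rigid motion, $\Omega$ coincides with the region strictly below the graph of a $C^1$ function of $n-1$ variables and $\partial\Omega$ coincides with that graph. *)

theory Defs
  imports "HOL-Analysis.Analysis"
begin

section \<open>Metric projection, skeleton and cut locus\<close>

text \<open>The distance function of an open set \<open>\<Omega>\<close> is \<open>\<lambda>x. infdist x (frontier \<Omega>)\<close>.\<close>

definition metric_projection :: "'a::metric_space set \<Rightarrow> 'a \<Rightarrow> 'a set" where
  "metric_projection \<Omega> x = {\<xi> \<in> frontier \<Omega>. infdist x (frontier \<Omega>) = dist \<xi> x}"

definition skeleton :: "'a::metric_space set \<Rightarrow> 'a set" where
  "skeleton \<Omega> = {x \<in> \<Omega>. \<not> is_singleton (metric_projection \<Omega> x)}"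

text \<open>The closure of the skeleton is taken relative to \<open>\<Omega>\<close>.\<close>

definition cut_locus :: "'a::metric_space set \<Rightarrow> 'a set" where
  "cut_locus \<Omega> = \<Omega> \<inter> closure (skeleton \<Omega>)"


section \<open>Inner radius of curvature\<close>

definition locally_inner_touching_ball ::
    "'a::metric_space set \<Rightarrow> 'a \<Rightarrow> 'a \<Rightarrow> real \<Rightarrow> bool" where
  "locally_inner_touching_ball \<Omega> \<xi> x r \<longleftrightarrow>
     r > 0 \<and> \<xi> \<in> frontier (ball x r) \<and>
     (\<exists>U. open U \<and> \<xi> \<in> U \<and> ball x r \<inter> U \<subseteq> \<Omega> \<inter> U)"

text \<open>Radii of curvature take values in \<open>[0, \<infinity>]\<close>, here as a part of \<^typ>\<open>ereal\<close>. The case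
  distinction is needed because the supremum of the empty set in \<^typ>\<open>ereal\<close> is \<open>-\<infinity>\<close>.\<close>

definition inner_radius :: "'a::metric_space set \<Rightarrow> 'a \<Rightarrow> ereal" where
  "inner_radius \<Omega> \<xi> =
     (if \<exists>x r. locally_inner_touching_ball \<Omega> \<xi> x r
      then Sup {ereal r |r. \<exists>x. locally_inner_touching_ball \<Omega> \<xi> x r}
      else 0)"

text \<open>The lower semicontinuous envelope of the inner radius of curvature on the boundary.
  The infimum includes the value at the centre \<open>\<xi>\<close> itself, so this is not the \<^const>\<open>Liminf\<close>
  along the punctured filter \<open>at \<xi> within frontier \<Omega>\<close>.\<close>

definition inner_radius_lsc :: "'a::metric_space set \<Rightarrow> 'a \<Rightarrow> ereal" where
  "inner_radius_lsc \<Omega> \<xi> =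
     Lim (at_right (0::real)) (\<lambda>r. INF \<eta> \<in> ball \<xi> r \<inter> frontier \<Omega>. inner_radius \<Omega> \<eta>)"


section \<open>Boundaries of class \<open>C\<^sup>1\<close>\<close>

definition rigid_motion :: "(real^'n \<Rightarrow> real^'n) \<Rightarrow> bool" where
  "rigid_motion T \<longleftrightarrow> (\<exists>R c. orthogonal_transformation R \<and> T = (\<lambda>y. R y + c))"

text \<open>A function of the \<open>n - 1\<close> coordinates other than the \<open>k\<close>-th one is represented by a function
  on the coordinate hyperplane \<open>{z. z $ k = 0}\<close>; its values elsewhere are irrelevant.\<close>

definition coord_hyperplane :: "'n \<Rightarrow> (real^'n) set" where
  "coord_hyperplane k = {z. z $ k = 0}"

definition drop_coord :: "'n \<Rightarrow> real^'n \<Rightarrow> real^'n" where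
  "drop_coord k y = (\<chi> i. if i = k then 0 else y $ i)"

text \<open>Only the restriction of the derivative \<open>g' z\<close> to the hyperplane is determined by \<open>g\<close>. This
  does no harm: precomposing a continuous \<open>g'\<close> with \<open>drop_coord k\<close> preserves continuity, so
  the condition says precisely that the partial derivatives of \<open>g\<close> in the \<open>n - 1\<close> directions of
  the hyperplane exist and are continuous there.\<close>

definition C1_on_hyperplane :: "'n \<Rightarrow> (real^'n \<Rightarrow> real) \<Rightarrow> bool" where
  "C1_on_hyperplane k g \<longleftrightarrow>
     (\<exists>g' :: real^'n \<Rightarrow> (real^'n) \<Rightarrow>\<^sub>L real.
        (\<forall>z \<in> coord_hyperplane k.
           (g has_derivative blinfun_apply (g' z)) (at z within coord_hyperplane k)) \<and>
        continuous_on (coord_hyperplane k) g')"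

definition C1_boundary :: "(real^'n) set \<Rightarrow> bool" where
  "C1_boundary \<Omega> \<longleftrightarrow>
     (\<forall>\<xi> \<in> frontier \<Omega>. \<exists>U T k g.
        open U \<and> \<xi> \<in> U \<and> rigid_motion T \<and> C1_on_hyperplane k g \<and>
        \<Omega> \<inter> U = {y \<in> U. T y $ k < g (drop_coord k (T y))} \<and>
        frontier \<Omega> \<inter> U = {y \<in> U. T y $ k = g (drop_coord k (T y))})"

end

theory Submission
  imports Defs
begin

text \<open>Let \<open>d\<close> denote the distance to the boundary. Both directions rest on the fact that the centre of an
  inner touching ball at a \<open>C\<^sup>1\<close> boundary point \<open>\<eta>\<close> is determined by \<open>\<eta>\<close> and the radius: it
  lies on the inner normal.

  If \<open>x\<close> is not in the cut locus, the projection is a continuous function \<open>p\<close> near \<open>x\<close>. Hence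
  \<open>y \<mapsto> (p y, d y)\<close>, read in a boundary chart, is continuous and injective, and by invariance of
  domain its image is a neighbourhood of \<open>(\<xi>, d x)\<close>. So every \<open>\<eta>\<close> near \<open>\<xi>\<close> has an inner touching
  ball of a fixed radius larger than \<open>d x\<close>.

  Conversely, suppose that all boundary points near \<open>\<xi>\<close> have locally inner touching balls of radius
  \<open>r > d x\<close>. For \<open>y\<close> near \<open>x\<close>, the squared distance from \<open>y\<close> to the graph point over \<open>z\<close> then has
  a strict affine support from below at every \<open>z\<close>, although only locally and without uniformity in
  \<open>z\<close>. This forbids interior maxima on segments, so the minimum over the graph is attained only
  once.\<close>

section \<open>Nearest boundary points and the touching balls at them\<close>

text \<open>Compactness: otherwise some \<open>y n\<close> tending to \<open>x\<close> have nearest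
  points \<open>q n\<close> that stay \<open>e\<close> away from \<open>\<xi>\<close>. These are
  bounded, and a subsequential limit is a nearest point of \<open>x\<close> other than
  \<open>\<xi>\<close>. Where the nearest point is unique on a set, this gives continuity of the
  projection there.\<close>

lemma closest_points_near:
  fixes S :: "'a::heine_borel set"
  assumes "closed S" and unique: "\<And>q. q \<in> S \<Longrightarrow> dist q x = infdist x S \<Longrightarrow> q = \<xi>" and "e > 0"
  shows "\<exists>\<delta>>0. \<forall>y q. dist y x < \<delta> \<longrightarrow> q \<in> S \<longrightarrow> dist q y = infdist y S \<longrightarrow> dist q \<xi> < e"
proof (rule ccontr)
  assume neg: "\<not> ?thesis"
  have "\<exists>y q. dist y x < inverse (real (Suc n)) \<and> q \<in> S \<and> dist q y = infdist y S \<and> dist q \<xi> \<ge> e" for n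
  proof -
    have "inverse (real (Suc n)) > 0" by simp
    with neg show ?thesis by (meson not_le)
  qed
  then obtain y q where yq: "\<And>n. dist (y n) x < inverse (real (Suc n))" "\<And>n. q n \<in> S"
    "\<And>n. dist (q n) (y n) = infdist (y n) S" "\<And>n. dist (q n) \<xi> \<ge> e" by metis
  have "\<forall>\<^sub>F n in sequentially. dist (y n) x \<le> inverse (real (Suc n))"
    by (intro always_eventually allI less_imp_le yq(1))
  then have "(\<lambda>n. dist (y n) x) \<longlonglongrightarrow> 0"
    by (intro tendsto_sandwich[OF _ _ tendsto_const LIMSEQ_inverse_real_of_nat]) simp
  then have y: "y \<longlonglongrightarrow> x" by (rule tendsto_dist_iff[THEN iffD2])
  have lim: "(\<lambda>n. infdist (y n) S) \<longlonglongrightarrow> infdist x S" by (intro tendsto_infdist y)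
  have "bounded (range q)"
  proof -
    obtain B where B: "\<And>n. dist x (y n) \<le> B"
      using convergent_imp_bounded[OF y] unfolding bounded_any_center[where a=x] by auto
    obtain C where C: "\<And>n. \<bar>infdist (y n) S\<bar> \<le> C"
      using convergent_imp_bounded[OF lim] unfolding bounded_iff by auto
    have "dist x (q n) \<le> B + C" for n
      using dist_triangle[of x "q n" "y n"] B[of n] C[of n] yq(3)[of n]
      by (simp add: dist_commute)
    then show ?thesis unfolding bounded_any_center[where a=x] by auto
  qed
  then obtain l and r :: "nat \<Rightarrow> nat" where r: "strict_mono r" "(q \<circ> r) \<longlonglongrightarrow> l"
    using bounded_imp_convergent_subsequence by blast
  have l: "l \<in> S"
    by (rule closed_sequentially[OF \<open>closed S\<close> _ r(2)]) (simp add: yq)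
  \<comment> \<open>The same sequence of distances has two descriptions of its limit, so
    \<open>l\<close> realises the distance from \<open>x\<close> to \<open>S\<close>.\<close>
  have "(\<lambda>n. dist ((q \<circ> r) n) ((y \<circ> r) n)) \<longlonglongrightarrow> dist l x"
    by (intro tendsto_dist r(2) LIMSEQ_subseq_LIMSEQ[OF y r(1)])
  moreover have "(\<lambda>n. dist ((q \<circ> r) n) ((y \<circ> r) n)) \<longlonglongrightarrow> infdist x S"
    using LIMSEQ_subseq_LIMSEQ[OF lim r(1)] by (simp add: o_def yq)
  ultimately have "dist l x = infdist x S" by (rule LIMSEQ_unique)
  with l have "l = \<xi>" by (rule unique)
  moreover have "e \<le> dist l \<xi>"
    by (rule tendsto_lowerbound[OF tendsto_dist[OF r(2) tendsto_const]]) (auto simp: yq)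
  ultimately show False using \<open>e > 0\<close> by simp
qed

text \<open>A ball is connected, so if it met both \<open>\<Omega>\<close> and the complement it
  would contain a frontier point, closer to \<open>y\<close> than the distance to the
  frontier.\<close>

lemma ball_infdist_frontier_subset:
  fixes \<Omega> :: "'a::real_normed_vector set"
  assumes "y \<in> \<Omega>"
  shows "ball y (infdist y (frontier \<Omega>)) \<subseteq> \<Omega>"
proof (rule ccontr)
  let ?B = "ball y (infdist y (frontier \<Omega>))"
  assume "\<not> ?B \<subseteq> \<Omega>"
  then have "?B - \<Omega> \<noteq> {}" by auto
  \<comment> \<open>A point of \<open>?B\<close> outside \<open>\<Omega>\<close> forces the radius
    to be positive, which puts the centre into the ball.\<close>
  moreover from this have "y \<in> ?B"
    by (auto intro: order.strict_trans1[OF zero_le_dist])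
  ultimately have "?B \<inter> frontier \<Omega> \<noteq> {}"
    using assms by (intro connected_Int_frontier connected_ball) blast+
  then obtain q where "q \<in> frontier \<Omega>" "dist y q < infdist y (frontier \<Omega>)" by auto
  then show False using infdist_le[of q "frontier \<Omega>" y] by simp
qed

lemma infdist_frontier_pos:
  assumes "open \<Omega>" "frontier \<Omega> \<noteq> {}" "y \<in> \<Omega>"
  shows "infdist y (frontier \<Omega>) > 0"
  by (rule infdist_pos_not_in_closed) (use assms in \<open>auto simp: frontier_def interior_open\<close>)

text \<open>Links projection and curvature: the ball around \<open>y\<close> that reaches its
  nearest point lies in \<open>\<Omega>\<close> as a whole, so the neighbourhood can be the whole
  space.\<close>

lemma locally_inner_touching_ball_closest:
  fixes \<Omega> :: "'a::real_normed_vector set"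
  assumes "open \<Omega>" "y \<in> \<Omega>" "\<eta> \<in> metric_projection \<Omega> y"
  shows "locally_inner_touching_ball \<Omega> \<eta> y (infdist y (frontier \<Omega>))"
proof -
  have \<eta>: "\<eta> \<in> frontier \<Omega>" "dist \<eta> y = infdist y (frontier \<Omega>)"
    using assms(3) by (auto simp: metric_projection_def)
  have pos: "infdist y (frontier \<Omega>) > 0"
    using infdist_frontier_pos[of \<Omega> y] assms \<eta> by blast
  show ?thesis unfolding locally_inner_touching_ball_def
  proof (intro conjI pos exI[of _ UNIV])
    show "\<eta> \<in> frontier (ball y (infdist y (frontier \<Omega>)))"
      using pos \<eta> by (simp add: dist_commute)
  qed (use ball_infdist_frontier_subset[OF assms(2)] in auto)
qed

lemma metric_projection_nonempty:
  fixes \<Omega> :: "'a::heine_borel set"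
  assumes "frontier \<Omega> \<noteq> {}"
  shows "metric_projection \<Omega> y \<noteq> {}"
  using infdist_attains_inf[OF frontier_closed assms, of y]
  by (auto simp: metric_projection_def dist_commute)

lemma closest_point_unique:
  assumes "metric_projection \<Omega> x = {\<xi>}" "q \<in> frontier \<Omega>" "dist q x = infdist x (frontier \<Omega>)"
  shows "q = \<xi>"
proof -
  have "q \<in> metric_projection \<Omega> x" using assms(2,3) by (simp add: metric_projection_def)
  then show ?thesis using assms(1) by simp
qed

section \<open>Inner radius of curvature and its envelope\<close>

lemma locally_inner_touching_ball_shrink:
  fixes \<Omega> :: "'a::euclidean_space set"
  assumes "locally_inner_touching_ball \<Omega> \<eta> c r" "0 < s" "s \<le> r"
  shows "\<exists>c'. locally_inner_touching_ball \<Omega> \<eta> c' s"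
proof -
  from assms obtain U where U: "r > 0" "dist c \<eta> = r" "open U" "\<eta> \<in> U" "ball c r \<inter> U \<subseteq> \<Omega> \<inter> U"
    by (auto simp: locally_inner_touching_ball_def)
  \<comment> \<open>Sliding the centre towards \<open>\<eta>\<close> gives a ball tangent from
    inside at \<open>\<eta>\<close>: its centre moves by exactly \<open>r - s\<close>.\<close>
  define c' where "c' = \<eta> + (s / r) *\<^sub>R (c - \<eta>)"
  have d: "dist c' \<eta> = s" using U assms by (simp add: c'_def dist_norm)
  have "c' - c = ((s - r) / r) *\<^sub>R (c - \<eta>)"
    using U(1) by (simp add: c'_def algebra_simps diff_divide_distrib)
  then have "dist c' c = r - s"
    using U(1,2) assms by (simp add: dist_norm)
  then have "ball c' s \<subseteq> ball c r"
    by (subst ball_subset_ball_iff) (auto simp: dist_commute)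
  then show ?thesis using U d assms(2)
    unfolding locally_inner_touching_ball_def by (intro exI[of _ c'] conjI exI[of _ U]) auto
qed

lemma inner_radius_ge:
  assumes "locally_inner_touching_ball \<Omega> \<eta> c r"
  shows "ereal r \<le> inner_radius \<Omega> \<eta>"
  using assms unfolding inner_radius_def by (auto intro!: Sup_upper)

lemma locally_inner_touching_ball_of_radius:
  fixes \<Omega> :: "'a::euclidean_space set"
  assumes "0 < s" "ereal s < inner_radius \<Omega> \<eta>"
  shows "\<exists>c. locally_inner_touching_ball \<Omega> \<eta> c s"
proof -
  \<comment> \<open>Since \<open>s\<close> is positive, the default value 0 of
    \<open>inner_radius\<close> is excluded.\<close>
  have "\<exists>x r. locally_inner_touching_ball \<Omega> \<eta> x r"
    using assms by (auto simp: inner_radius_def split: if_splits)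
  with assms(2) obtain r c where "s < r" "locally_inner_touching_ball \<Omega> \<eta> c r"
    by (auto simp: inner_radius_def less_Sup_iff split: if_splits)
  then show ?thesis using locally_inner_touching_ball_shrink assms(1) by (meson less_imp_le)
qed

text \<open>The infima grow as the ball shrinks, so the limit in the definition exists and is a
  supremum. Strict bounds on the envelope thereby become bounds on one fixed ball.\<close>

lemma inner_radius_lsc_eq:
  "inner_radius_lsc \<Omega> \<xi> = (SUP r\<in>{0<..}. INF \<eta>\<in>ball \<xi> r \<inter> frontier \<Omega>. inner_radius \<Omega> \<eta>)"
  (is "_ = (SUP r\<in>_. ?F r)")
proof -
  have anti: "?F s \<le> ?F r" if "r \<le> s" for r s
    by (rule INF_superset_mono) (use that in auto)
  have "(?F \<longlongrightarrow> (SUP r\<in>{0<..}. ?F r)) (at_right 0)"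
  proof (rule order_tendstoI)
    fix a assume "a < (SUP r\<in>{0<..}. ?F r)"
    then obtain s where s: "s > 0" "a < ?F s" by (auto simp: less_SUP_iff)
    then have "\<forall>r>0. r < s \<longrightarrow> a < ?F r" using anti by (meson less_imp_le order.strict_trans2)
    then show "\<forall>\<^sub>F r in at_right 0. a < ?F r"
      unfolding eventually_at_right_field using s(1) by blast
  next
    fix a assume a: "(SUP r\<in>{0<..}. ?F r) < a"
    have "?F r < a" if "r > 0" for r
      by (rule order.strict_trans1[OF SUP_upper a]) (use that in simp)
    then show "\<forall>\<^sub>F r in at_right 0. ?F r < a"
      by (auto simp: eventually_at_right_field intro: exI[of _ 1])
  qed
  then show ?thesis unfolding inner_radius_lsc_def
    by (intro tendsto_Lim) auto
qed

section \<open>Rigid motions and graph coordinates\<close>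

lemma rigid_motion_dist:
  assumes "rigid_motion T"
  shows "dist (T a) (T b) = dist a b"
proof -
  obtain R c where R: "orthogonal_transformation R" "T = (\<lambda>y. R y + c)"
    using assms by (auto simp: rigid_motion_def)
  then show ?thesis
    by (simp add: orthogonal_transformation_isometry)
qed

lemma rigid_motion_bij:
  assumes "rigid_motion T"
  shows "bij T"
proof -
  obtain R c where R: "orthogonal_transformation R" "T = (\<lambda>y. R y + c)"
    using assms by (auto simp: rigid_motion_def)
  have "bij ((\<lambda>y. y + c) \<circ> R)"
    by (intro bij_comp orthogonal_transformation_bij R bij_plus_right)
  then show ?thesis by (simp add: R(2) o_def)
qed

lemma drop_coord_nth [simp]: "drop_coord k y $ i = (if i = k then 0 else y $ i)"
  by (simp add: drop_coord_def)

lemma drop_coord_in_hyperplane [simp]: "drop_coord k y \<in> coord_hyperplane k"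
  by (simp add: coord_hyperplane_def)

lemma drop_coord_decompose: "drop_coord k y + y $ k *\<^sub>R axis k 1 = y"
  by (auto simp: vec_eq_iff axis_def)

lemma linear_drop_coord: "linear (drop_coord k)"
  by (rule linearI) (auto simp: vec_eq_iff)

lemma norm_drop_coord_le: "norm (drop_coord k y) \<le> norm y"
  by (rule norm_le_componentwise_cart) simp

lemma dist_drop_coord_le: "dist (drop_coord k y) (drop_coord k z) \<le> dist y z"
  by (metis dist_norm linear_diff[OF linear_drop_coord] norm_drop_coord_le)

definition graph_point :: "'n \<Rightarrow> (real^'n \<Rightarrow> real) \<Rightarrow> real^'n \<Rightarrow> real^'n" where
  "graph_point k g z = z + g z *\<^sub>R axis k 1"

text \<open>With \<open>D\<close> the derivative of \<open>g\<close>, this is the gradient of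
  \<open>y $ k - g (drop_coord k y)\<close>. It points out of the region below the graph and is
  scaled to have height 1 instead of length 1.\<close>

definition graph_normal :: "'n \<Rightarrow> ((real^'n) \<Rightarrow>\<^sub>L real) \<Rightarrow> real^'n" where
  "graph_normal k D = (\<chi> i. if i = k then 1 else - blinfun_apply D (axis i 1))"

lemma graph_normal_nth_self [simp]: "graph_normal k D $ k = 1"
  by (simp add: graph_normal_def)

lemma graph_normal_nonzero [simp]: "graph_normal k D \<noteq> 0"
  by (metis graph_normal_nth_self zero_index zero_neq_one)

lemma graph_normal_inner:
  "graph_normal k D \<bullet> v = v $ k - blinfun_apply D (drop_coord k v)"
proof -
  have "drop_coord k v = (\<Sum>i\<in>UNIV. drop_coord k v $ i *\<^sub>R axis i 1)"
    by (simp add: basis_expansion del: drop_coord_nth flip: scalar_mult_eq_scaleR)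
  then have "blinfun_apply D (drop_coord k v) = blinfun_apply D (\<Sum>i\<in>UNIV. drop_coord k v $ i *\<^sub>R axis i 1)"
    by (rule arg_cong)
  then have "blinfun_apply D (drop_coord k v) = (\<Sum>i\<in>UNIV. drop_coord k v $ i * blinfun_apply D (axis i 1))"
    by (simp add: blinfun.scaleR_right blinfun.sum_right del: drop_coord_nth)
  moreover have "graph_normal k D \<bullet> v
      = (\<Sum>i\<in>UNIV. (if i = k then v $ i else 0) - drop_coord k v $ i * blinfun_apply D (axis i 1))"
    by (auto simp: inner_vec_def graph_normal_def intro!: sum.cong)
  ultimately show ?thesis by (simp add: sum_subtractf)
qed

section \<open>Two facts about real inner product spaces\<close>

text \<open>Test with the bisector \<open>norm u *\<^sub>R N + norm N *\<^sub>R u\<close>: its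
  products with \<open>u\<close> and with \<open>N\<close> both have the sign of
  \<open>u \<bullet> N + norm u * norm N\<close>. This number is therefore at most 0, which is the
  equality case of Cauchy-Schwarz.\<close>

lemma opposite_of_positive_halfspace:
  fixes u N :: "'a::real_inner"
  assumes "u \<noteq> 0" "N \<noteq> 0" and neg: "\<And>v. v \<bullet> u > 0 \<Longrightarrow> N \<bullet> v \<le> 0"
  shows "u = - (norm u / norm N) *\<^sub>R N"
proof -
  have "u \<bullet> N + norm u * norm N \<le> 0"
  proof (rule ccontr)
    assume *: "\<not> ?thesis"
    define v where "v = norm u *\<^sub>R N + norm N *\<^sub>R u"
    have "v \<bullet> u = norm u * (u \<bullet> N + norm u * norm N)"
      by (simp add: v_def inner_add_left distrib_left inner_commute[of N u] power2_eq_square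
          flip: power2_norm_eq_inner)
    moreover have "N \<bullet> v = norm N * (u \<bullet> N + norm u * norm N)"
      by (simp add: v_def inner_add_right distrib_left inner_commute[of N u] power2_eq_square
          flip: power2_norm_eq_inner)
    ultimately show False using neg[of v] * assms(1,2) by (simp add: mult_le_0_iff)
  qed
  then have "u \<bullet> (- N) = norm u * norm (- N)"
    using Cauchy_Schwarz_ineq2[of u N] by auto
  then have "norm u *\<^sub>R (- N) = norm N *\<^sub>R u"
    by (subst (asm) norm_cauchy_schwarz_eq) simp
  then have "norm N *\<^sub>R u = norm N *\<^sub>R (- (norm u / norm N) *\<^sub>R N)" using assms by simp
  then show ?thesis using assms by (simp only: scaleR_cancel_left) simp
qed

text \<open>On the segment between two minimisers \<open>f\<close> would have an interior maximum,
  and a strict support from below there is impossible. The argument uses the support at a single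
  point, so \<open>e\<close> may depend on \<open>z\<close>.\<close>

lemma strict_local_support_unique_minimum:
  fixes f :: "'a::real_inner \<Rightarrow> real"
  assumes "convex A" "continuous_on A f"
    and supp: "\<And>z. z \<in> A \<Longrightarrow> \<exists>b. \<exists>e>0. \<forall>w\<in>A. dist w z < e \<longrightarrow> w \<noteq> z \<longrightarrow> f z + (w - z) \<bullet> b < f w"
    and z: "z\<^sub>1 \<in> A" "z\<^sub>2 \<in> A" and min: "\<And>z. z \<in> A \<Longrightarrow> f z\<^sub>1 \<le> f z" "\<And>z. z \<in> A \<Longrightarrow> f z\<^sub>2 \<le> f z"
  shows "z\<^sub>1 = z\<^sub>2"
proof (rule ccontr)
  assume ne: "z\<^sub>1 \<noteq> z\<^sub>2"
  define \<gamma> where "\<gamma> t = z\<^sub>1 + t *\<^sub>R (z\<^sub>2 - z\<^sub>1)" for t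
  have \<gamma>A: "\<gamma> t \<in> A" if "t \<in> {0..1}" for t
    using convexD_alt[OF \<open>convex A\<close> z, of t] that by (simp add: \<gamma>_def algebra_simps)
  have "continuous_on {0..1} (\<lambda>t. f (\<gamma> t))"
    by (rule continuous_on_compose2[OF assms(2)]) (use \<gamma>A in \<open>auto simp: \<gamma>_def intro!: continuous_intros\<close>)
  then have "\<exists>t\<in>{0..1}. \<forall>u\<in>{0..1}. f (\<gamma> u) \<le> f (\<gamma> t)"
    by (intro continuous_attains_sup) simp_all
  then obtain t\<^sub>0 where t\<^sub>0: "t\<^sub>0 \<in> {0..1}" "\<And>t. t \<in> {0..1} \<Longrightarrow> f (\<gamma> t) \<le> f (\<gamma> t\<^sub>0)"
    by blast
  \<comment> \<open>If the maximum sits at an endpoint, which is a minimiser, then \<open>f\<close>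
    is constant on the segment and the midpoint is a maximum as well.\<close>
  define t\<^sub>1 where "t\<^sub>1 = (if t\<^sub>0 \<in> {0, 1} then 1 / 2 else t\<^sub>0)"
  have t\<^sub>1: "0 < t\<^sub>1" "t\<^sub>1 < 1" using t\<^sub>0(1) by (auto simp: t\<^sub>1_def)
  have "f (\<gamma> t\<^sub>0) \<le> f (\<gamma> t\<^sub>1)"
  proof -
    have "\<gamma> 0 = z\<^sub>1" "\<gamma> 1 = z\<^sub>2" by (simp_all add: \<gamma>_def)
    then show ?thesis using min \<gamma>A[of "1 / 2"] by (auto simp: t\<^sub>1_def)
  qed
  then have max: "f (\<gamma> t) \<le> f (\<gamma> t\<^sub>1)" if "t \<in> {0..1}" for t using t\<^sub>0(2)[OF that] by simp
  obtain b e where e: "e > 0"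
    "\<And>w. w \<in> A \<Longrightarrow> dist w (\<gamma> t\<^sub>1) < e \<Longrightarrow> w \<noteq> \<gamma> t\<^sub>1 \<Longrightarrow> f (\<gamma> t\<^sub>1) + (w - \<gamma> t\<^sub>1) \<bullet> b < f w"
    using supp[OF \<gamma>A[of t\<^sub>1]] t\<^sub>1 by auto
  define m where "m = norm (z\<^sub>2 - z\<^sub>1)"
  have m: "m > 0" using ne by (simp add: m_def)
  \<comment> \<open>Small enough for both points \<open>t\<^sub>1 + h\<close> and
    \<open>t\<^sub>1 - h\<close> to stay in the unit interval and within the support radius.\<close>
  define h where "h = min (min t\<^sub>1 (1 - t\<^sub>1)) (e / (2 * m))"
  have h: "h > 0" "h \<le> t\<^sub>1" "h \<le> 1 - t\<^sub>1" "h \<le> e / (2 * m)" using t\<^sub>1 e(1) m by (auto simp: h_def)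
  have "h * m \<le> e / 2" using h(4) m by (simp add: field_simps)
  then have hm: "h * m < e" using e(1) by linarith
  have step: "f (\<gamma> t\<^sub>1) + s * ((z\<^sub>2 - z\<^sub>1) \<bullet> b) < f (\<gamma> (t\<^sub>1 + s))" if "\<bar>s\<bar> = h" for s
  proof -
    have d: "\<gamma> (t\<^sub>1 + s) - \<gamma> t\<^sub>1 = s *\<^sub>R (z\<^sub>2 - z\<^sub>1)" by (simp add: \<gamma>_def algebra_simps)
    have "\<gamma> (t\<^sub>1 + s) \<in> A" by (rule \<gamma>A) (use that h in auto)
    moreover have "dist (\<gamma> (t\<^sub>1 + s)) (\<gamma> t\<^sub>1) < e" using hm that by (simp add: dist_norm d m_def)
    moreover have "\<gamma> (t\<^sub>1 + s) \<noteq> \<gamma> t\<^sub>1" using d that h(1) ne by auto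
    ultimately have "f (\<gamma> t\<^sub>1) + (\<gamma> (t\<^sub>1 + s) - \<gamma> t\<^sub>1) \<bullet> b < f (\<gamma> (t\<^sub>1 + s))" by (rule e(2))
    then show ?thesis by (simp add: d)
  qed
  have "f (\<gamma> (t\<^sub>1 + h)) \<le> f (\<gamma> t\<^sub>1)" "f (\<gamma> (t\<^sub>1 + - h)) \<le> f (\<gamma> t\<^sub>1)"
    by (rule max; use h t\<^sub>1 in simp)+
  \<comment> \<open>At a maximum, both \<open>h\<close> and \<open>- h\<close> times the slope
    \<open>(z\<^sub>2 - z\<^sub>1) \<bullet> b\<close> would have to be negative.\<close>
  then show False using step[of h] step[of "- h"] h(1) by simp
qed

section \<open>A single boundary chart\<close>

text \<open>Unpacks \<open>C1_boundary\<close> at one boundary point and fixes a derivative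
  \<open>g'\<close>, so that the normal becomes a function on the hyperplane. \<open>T\<close>
  carries points to chart coordinates, where \<open>\<Omega>\<close> lies below the graph.\<close>

locale C1_graph_chart =
  fixes \<Omega> U :: "(real^'n) set" and T :: "real^'n \<Rightarrow> real^'n" and k :: 'n and g :: "real^'n \<Rightarrow> real"
    and g' :: "real^'n \<Rightarrow> (real^'n) \<Rightarrow>\<^sub>L real"
  assumes open_domain: "open \<Omega>" and open_U: "open U" and rigid: "rigid_motion T"
    and deriv: "\<And>z. z \<in> coord_hyperplane k \<Longrightarrow>
      (g has_derivative blinfun_apply (g' z)) (at z within coord_hyperplane k)"
    and cont_deriv: "continuous_on (coord_hyperplane k) g'"
    and domain_eq: "\<Omega> \<inter> U = {y \<in> U. T y $ k < g (drop_coord k (T y))}"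
    and frontier_eq: "frontier \<Omega> \<inter> U = {y \<in> U. T y $ k = g (drop_coord k (T y))}"
begin

abbreviation "H \<equiv> coord_hyperplane k"
abbreviation "G \<equiv> graph_point k g"
abbreviation "\<nu> z \<equiv> graph_normal k (g' z)"

lemma dist_T [simp]: "dist (T a) (T b) = dist a b"
  by (rule rigid_motion_dist[OF rigid])

lemma T_inv [simp]: "T (inv T a) = a"
  by (rule surj_f_inv_f[OF bij_is_surj[OF rigid_motion_bij[OF rigid]]])

lemma inv_T [simp]: "inv T (T a) = a"
  by (rule inv_f_f[OF bij_is_inj[OF rigid_motion_bij[OF rigid]]])

lemma dist_inv_T: "dist (inv T a) b = dist a (T b)"
  using dist_T[of "inv T a" b] unfolding T_inv by (rule sym)

lemma T_eq_iff [simp]: "T a = T b \<longleftrightarrow> a = b"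
  using dist_T[of a b] by (metis dist_eq_0_iff)

lemma continuous_on_inv_T: "continuous_on A (inv T)"
  unfolding continuous_on_iff by (auto simp: dist_inv_T)

lemma continuous_on_T: "continuous_on A T"
  unfolding continuous_on_iff by auto

lemma continuous_on_g: "continuous_on H g"
  using deriv by (rule has_derivative_continuous_on)

lemma continuous_on_graph: "continuous_on H G"
  unfolding graph_point_def by (intro continuous_intros continuous_on_g)

text \<open>Continuity of the derivative enters here. It controls the centres of touching balls of a
  fixed radius as the boundary point varies.\<close>

lemma continuous_on_normal: "continuous_on H (\<lambda>z. \<nu> z)"
  unfolding graph_normal_def
proof (intro continuous_on_vec_lambda)
  fix i
  show "continuous_on H (\<lambda>z. if i = k then 1 else - blinfun_apply (g' z) (axis i 1))"
  proof (cases "i = k")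
    case False
    have "continuous_on H (\<lambda>z. - blinfun_apply (g' z) (axis i 1))"
      by (rule continuous_on_minus[OF blinfun.continuous_on[OF cont_deriv continuous_on_const]])
    then show ?thesis using False by simp
  qed simp
qed

lemma graph_drop:
  assumes "\<eta> \<in> frontier \<Omega>" "\<eta> \<in> U"
  shows "G (drop_coord k (T \<eta>)) = T \<eta>"
proof -
  have "T \<eta> $ k = g (drop_coord k (T \<eta>))" using assms frontier_eq by auto
  then show ?thesis using drop_coord_decompose[of k "T \<eta>"] by (simp only: graph_point_def)
qed

lemma graph_nth: "z \<in> H \<Longrightarrow> G z $ k = g z"
  by (simp add: graph_point_def coord_hyperplane_def)

lemma drop_graph: "z \<in> H \<Longrightarrow> drop_coord k (G z) = z"
  by (auto simp: graph_point_def coord_hyperplane_def vec_eq_iff axis_def)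

lemma inv_T_graph_frontier:
  assumes "z \<in> H" "inv T (G z) \<in> U"
  shows "inv T (G z) \<in> frontier \<Omega>"
proof -
  have "inv T (G z) \<in> {y \<in> U. T y $ k = g (drop_coord k (T y))}"
    using assms by (simp add: graph_nth drop_graph)
  then show ?thesis using frontier_eq by blast
qed

section \<open>Touching balls are centred on the inner normal\<close>

text \<open>A direction \<open>v\<close> with positive product with \<open>u\<close> leads from
  \<open>T \<eta>\<close> into the ball, hence below the graph; positive product with the normal
  would lead above it. So the half-space lemma applies to \<open>u\<close> and the normal.\<close>

lemma touching_ball_center:
  assumes \<eta>: "\<eta> \<in> frontier \<Omega>" "\<eta> \<in> U" and touch: "locally_inner_touching_ball \<Omega> \<eta> c r"
  shows "T c = T \<eta> - (r / norm (\<nu> (drop_coord k (T \<eta>)))) *\<^sub>R \<nu> (drop_coord k (T \<eta>))"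
proof -
  define z where "z = drop_coord k (T \<eta>)"
  define u where "u = T c - T \<eta>"
  from touch obtain V where V: "r > 0" "dist c \<eta> = r" "open V" "\<eta> \<in> V" "ball c r \<inter> V \<subseteq> \<Omega> \<inter> V"
    by (auto simp: locally_inner_touching_ball_def)
  have normu: "norm u = r" using V by (simp add: u_def flip: dist_norm)
  have gz: "T \<eta> $ k = g z" using \<eta> frontier_eq by (auto simp: z_def)
  have "\<nu> z \<bullet> v \<le> 0" if v: "v \<bullet> u > 0" for v
  proof (rule ccontr)
    assume "\<not> \<nu> z \<bullet> v \<le> 0"
    then have pos: "\<nu> z \<bullet> v > 0" by simp
    \<comment> \<open>The height of \<open>T \<eta> + t *\<^sub>R v\<close> above the graph is
      \<open>\<psi> t - \<psi> 0\<close>.\<close>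
    define \<psi> where "\<psi> t = t * v $ k - g (z + t *\<^sub>R drop_coord k v)" for t
    have H: "z + t *\<^sub>R drop_coord k v \<in> H" for t
      by (simp add: coord_hyperplane_def z_def)
    have "((\<lambda>t. g (z + t *\<^sub>R drop_coord k v)) has_derivative
            (\<lambda>t. blinfun_apply (g' z) (t *\<^sub>R drop_coord k v))) (at 0 within UNIV)"
    proof (rule has_derivative_in_compose[where g=g and g'="blinfun_apply (g' z)"])
      show "(g has_derivative blinfun_apply (g' z))
        (at (z + 0 *\<^sub>R drop_coord k v) within range (\<lambda>t. z + t *\<^sub>R drop_coord k v))"
        using H deriv[of z] by (auto intro: has_derivative_subset simp: z_def)
      show "((\<lambda>t. z + t *\<^sub>R drop_coord k v) has_derivative (\<lambda>t. t *\<^sub>R drop_coord k v)) (at 0)"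
        by (auto intro!: derivative_eq_intros)
    qed
    then have "(\<psi> has_derivative (\<lambda>t. t * v $ k - blinfun_apply (g' z) (t *\<^sub>R drop_coord k v))) (at 0)"
      unfolding \<psi>_def by (auto intro!: derivative_eq_intros)
    then have "(\<psi> has_real_derivative \<nu> z \<bullet> v) (at 0)"
      unfolding has_field_derivative_def
      by (rule has_derivative_eq_rhs) (auto simp: graph_normal_inner blinfun.scaleR_right algebra_simps)
    from has_real_derivative_pos_inc_right[OF this pos]
    obtain d where d: "d > 0" "\<And>h. 0 < h \<Longrightarrow> h < d \<Longrightarrow> \<psi> 0 < \<psi> h" by auto
    have "continuous_on UNIV (\<lambda>t. inv T (T \<eta> + t *\<^sub>R v))"
      by (rule continuous_on_compose2[OF continuous_on_inv_T[of UNIV]]) (auto intro!: continuous_intros)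
    then have "open ((\<lambda>t. inv T (T \<eta> + t *\<^sub>R v)) -` (U \<inter> V))"
      by (intro open_vimage open_Int open_U V)
    moreover have "0 \<in> (\<lambda>t. inv T (T \<eta> + t *\<^sub>R v)) -` (U \<inter> V)" using \<eta> V by simp
    ultimately obtain e where "e > 0" "ball 0 e \<subseteq> (\<lambda>t. inv T (T \<eta> + t *\<^sub>R v)) -` (U \<inter> V)"
      by (rule openE)
    then have e: "e > 0" "\<And>t. \<bar>t\<bar> < e \<Longrightarrow> inv T (T \<eta> + t *\<^sub>R v) \<in> U \<inter> V"
      by (auto simp: subset_iff)
    have vn: "norm v > 0" using v by auto
    \<comment> \<open>The three bounds keep the point above the graph, inside both neighbourhoods
      and inside the ball; for the last, the squared distance to the centre is
      \<open>r\<^sup>2 - t * (2 * (v \<bullet> u) - t * (norm v)\<^sup>2)\<close>.\<close>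
    define t where "t = min (min (d/2) (e/2)) ((v \<bullet> u) / (norm v)\<^sup>2)"
    have t: "t > 0" "t < d" "t < e" "t \<le> (v \<bullet> u) / (norm v)\<^sup>2" using d(1) e(1) v vn by (auto simp: t_def)
    have "(dist (T \<eta> + t *\<^sub>R v) (T c))\<^sup>2 = (norm (t *\<^sub>R v - u))\<^sup>2"
      by (simp add: u_def dist_norm algebra_simps)
    also have "\<dots> = r\<^sup>2 - t * (2 * (v \<bullet> u) - t * (norm v)\<^sup>2)"
      unfolding normu[symmetric] power2_norm_eq_inner
      by (simp add: inner_diff_left inner_diff_right inner_commute algebra_simps)
    also have "\<dots> < r\<^sup>2"
    proof -
      have "t * (norm v)\<^sup>2 \<le> v \<bullet> u" using t(4) vn by (simp add: field_simps)
      then show ?thesis using t(1) v by simp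
    qed
    finally have "dist (T \<eta> + t *\<^sub>R v) (T c) < r" using V(1) by (simp add: power_less_imp_less_base)
    then have "inv T (T \<eta> + t *\<^sub>R v) \<in> ball c r" by (metis dist_commute dist_inv_T mem_ball)
    then have "inv T (T \<eta> + t *\<^sub>R v) \<in> \<Omega> \<inter> U" using V(5) e(2)[of t] t by auto
    then have "(T \<eta> + t *\<^sub>R v) $ k < g (drop_coord k (T \<eta> + t *\<^sub>R v))" unfolding domain_eq by auto
    then have "g z + t * v $ k < g (z + t *\<^sub>R drop_coord k v)"
      by (simp add: gz z_def linear_add[OF linear_drop_coord] linear_scale[OF linear_drop_coord])
    with d(2)[OF t(1,2)] show False by (simp add: \<psi>_def)
  qed
  moreover have "u \<noteq> 0" using normu V(1) by auto
  ultimately have "u = - (norm u / norm (\<nu> z)) *\<^sub>R \<nu> z"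
    by (intro opposite_of_positive_halfspace) auto
  then show ?thesis unfolding normu unfolding u_def z_def by (simp add: algebra_simps)
qed

section \<open>Strict affine support for the squared distance\<close>

lemma eventually_inv_T_graph:
  assumes "z \<in> H" "open W" "inv T (G z) \<in> W"
  shows "\<exists>e>0. \<forall>w\<in>H. dist w z < e \<longrightarrow> inv T (G w) \<in> W"
proof -
  have "continuous_on H (\<lambda>w. inv T (G w))"
    by (rule continuous_on_compose2[OF continuous_on_inv_T[of UNIV] continuous_on_graph]) auto
  then have "((\<lambda>w. inv T (G w)) \<longlongrightarrow> inv T (G z)) (at z within H)"
    using assms(1) by (simp add: continuous_on_def)
  then have "\<forall>\<^sub>F w in at z within H. inv T (G w) \<in> W"
    using assms(2,3) by (rule topological_tendstoD)
  then show ?thesis using assms(3) unfolding eventually_at by metis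
qed

text \<open>Put \<open>P q = \<bar>q - Y\<bar>\<^sup>2 - \<mu> (\<bar>q - C\<bar>\<^sup>2 - r\<^sup>2)\<close>. It is a lower bound for \<open>\<bar>q - Y\<bar>\<^sup>2\<close> on the graph, which
  avoids the touching ball. The factor \<open>\<mu>\<close> makes the derivative of \<open>P\<close> in the vertical direction
  vanish at the touching point, so the linear part of \<open>P\<close> does not see \<open>g\<close>.\<close>

lemma strict_local_support:
  assumes z: "z \<in> H" "inv T (G z) \<in> U"
    and touch: "locally_inner_touching_ball \<Omega> (inv T (G z)) c r"
    and Y: "T c $ k < Y $ k" "Y $ k < g z"
  shows "\<exists>b. \<exists>e>0. \<forall>w\<in>H. dist w z < e \<longrightarrow> w \<noteq> z \<longrightarrow>
    (dist (G z) Y)\<^sup>2 + (w - z) \<bullet> b < (dist (G w) Y)\<^sup>2"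
proof -
  define C where "C = T c"
  define \<mu> where "\<mu> = (g z - Y $ k) / (g z - C $ k)"
  have \<mu>: "0 < \<mu>" "\<mu> < 1" "\<mu> * (g z - C $ k) = g z - Y $ k"
    using Y by (auto simp: \<mu>_def C_def)
  define b where "b = (G z - Y) - \<mu> *\<^sub>R (G z - C)"
  have bk: "b $ k = 0" using \<mu>(3) by (simp add: b_def graph_nth[OF z(1)])
  from touch obtain V where V: "r > 0" "dist c (inv T (G z)) = r" "open V" "inv T (G z) \<in> V"
      "ball c r \<inter> V \<subseteq> \<Omega> \<inter> V"
    by (auto simp: locally_inner_touching_ball_def)
  have rz: "(norm (G z - C))\<^sup>2 = r\<^sup>2"
    using V(2) by (metis C_def dist_T T_inv dist_norm dist_commute)
  obtain e where e: "e > 0" "\<And>w. w \<in> H \<Longrightarrow> dist w z < e \<Longrightarrow> inv T (G w) \<in> U \<inter> V"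
    using eventually_inv_T_graph[OF z(1) open_Int[OF open_U V(3)]] z V(4) by auto
  have "(dist (G z) Y)\<^sup>2 + (w - z) \<bullet> (2 *\<^sub>R b) < (dist (G w) Y)\<^sup>2"
    if w: "w \<in> H" "dist w z < e" "w \<noteq> z" for w
  proof -
    have "inv T (G w) \<in> frontier \<Omega>" using inv_T_graph_frontier e(2) w by blast
    then have "inv T (G w) \<notin> ball c r"
      using e(2)[OF w(1,2)] V(5) open_domain by (auto simp: frontier_def interior_open)
    then have "r \<le> norm (G w - C)" by (metis C_def dist_T T_inv dist_commute dist_norm mem_ball not_less)
    then have rw: "r\<^sup>2 \<le> (norm (G w - C))\<^sup>2" using V(1) by (intro power_mono) auto
    define h where "h = G w - G z"
    \<comment> \<open>The height difference \<open>g w - g z\<close> drops out because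
      \<open>b\<close> is horizontal.\<close>
    have hb: "h \<bullet> b = (w - z) \<bullet> b"
    proof -
      have "h = (w - z) + (g w - g z) *\<^sub>R axis k 1" by (simp add: h_def graph_point_def algebra_simps)
      then show ?thesis using bk by (simp add: inner_add_left inner_axis')
    qed
    have "h \<noteq> 0" using w(1,3) z(1) drop_graph by (metis h_def right_minus_eq)
    have "(norm (G w - p))\<^sup>2 = (norm (G z - p))\<^sup>2 + 2 * (h \<bullet> (G z - p)) + (norm h)\<^sup>2" for p
    proof -
      have "(norm (a + h))\<^sup>2 = (norm a)\<^sup>2 + 2 * (h \<bullet> a) + (norm h)\<^sup>2" for a
        unfolding power2_norm_eq_inner by (simp add: inner_add_left inner_add_right inner_commute)
      moreover have "G w - p = (G z - p) + h" by (simp add: h_def)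
      ultimately show ?thesis by (simp only:)
    qed
    note expand = this[of Y] this[of C]
    \<comment> \<open>The left side is the exact quadratic expansion of \<open>P\<close> about
      \<open>G z\<close>, a point of the touching sphere. Strictness comes from its leading
      coefficient \<open>1 - \<mu>\<close>.\<close>
    have "(norm (G z - Y))\<^sup>2 + 2 * (h \<bullet> b) + (1 - \<mu>) * (norm h)\<^sup>2
        = (norm (G w - Y))\<^sup>2 - \<mu> * ((norm (G w - C))\<^sup>2 - r\<^sup>2)"
      unfolding expand rz b_def by (simp add: inner_diff_right algebra_simps)
    also have "\<dots> \<le> (norm (G w - Y))\<^sup>2" using \<mu> rw by simp
    finally have "(norm (G z - Y))\<^sup>2 + 2 * (h \<bullet> b) + (1 - \<mu>) * (norm h)\<^sup>2 \<le> (norm (G w - Y))\<^sup>2" .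
    moreover have "(1 - \<mu>) * (norm h)\<^sup>2 > 0" using \<mu> \<open>h \<noteq> 0\<close> by simp
    ultimately show ?thesis by (simp add: dist_norm hb)
  qed
  then show ?thesis using e(1) by blast
qed

section \<open>From the curvature bound to unique nearest points\<close>

lemma not_in_closure_skeleton:
  assumes x: "x \<in> \<Omega>" and proj: "metric_projection \<Omega> x = {\<xi>}" and "\<xi> \<in> U"
    and lsc: "ereal (infdist x (frontier \<Omega>)) < inner_radius_lsc \<Omega> \<xi>"
  shows "x \<notin> closure (skeleton \<Omega>)"
proof -
  define d where "d = infdist x (frontier \<Omega>)"
  have \<xi>: "\<xi> \<in> frontier \<Omega>" "\<xi> \<in> metric_projection \<Omega> x" using proj by (auto simp: metric_projection_def)
  have d: "d > 0" unfolding d_def using infdist_frontier_pos[OF open_domain _ x] \<xi> by blast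
  from lsc obtain s where s: "s > 0" "ereal d < (INF \<eta>\<in>ball \<xi> s \<inter> frontier \<Omega>. inner_radius \<Omega> \<eta>)"
    unfolding inner_radius_lsc_eq d_def by (auto simp: less_SUP_iff)
  \<comment> \<open>A real radius strictly below the local infimum, so that balls of exactly this
    radius touch at all nearby boundary points.\<close>
  then obtain r where r: "d < r" "ereal r < (INF \<eta>\<in>ball \<xi> s \<inter> frontier \<Omega>. inner_radius \<Omega> \<eta>)"
    using ereal_dense2[OF s(2)] by auto
  have touch: "\<exists>c. locally_inner_touching_ball \<Omega> \<eta> c r" if "\<eta> \<in> ball \<xi> s" "\<eta> \<in> frontier \<Omega>" for \<eta>
  proof (rule locally_inner_touching_ball_of_radius)
    have "(INF \<eta>\<in>ball \<xi> s \<inter> frontier \<Omega>. inner_radius \<Omega> \<eta>) \<le> inner_radius \<Omega> \<eta>"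
      by (rule INF_lower) (use that in simp)
    then show "ereal r < inner_radius \<Omega> \<eta>" by (rule order.strict_trans2[OF r(2)])
  qed (use d r(1) in simp)
  define z\<^sub>0 where "z\<^sub>0 = drop_coord k (T \<xi>)"
  have z\<^sub>0: "z\<^sub>0 \<in> H" "G z\<^sub>0 = T \<xi>" using graph_drop[OF \<xi>(1) \<open>\<xi> \<in> U\<close>] by (auto simp: z\<^sub>0_def)
  define N\<^sub>0 where "N\<^sub>0 = norm (\<nu> z\<^sub>0)"
  have N\<^sub>0: "N\<^sub>0 > 0" by (simp add: N\<^sub>0_def)
  have "T x = T \<xi> - (d / N\<^sub>0) *\<^sub>R \<nu> z\<^sub>0"
    using touching_ball_center[OF \<xi>(1) \<open>\<xi> \<in> U\<close> locally_inner_touching_ball_closest[OF open_domain x \<xi>(2)]]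
    by (simp add: N\<^sub>0_def z\<^sub>0_def d_def)
  then have Tx: "T x $ k = g z\<^sub>0 - d / N\<^sub>0" using graph_nth[OF z\<^sub>0(1)] by (simp add: z\<^sub>0(2))
  have "g z\<^sub>0 - r / N\<^sub>0 < T x $ k" "T x $ k < g z\<^sub>0"
    using N\<^sub>0 d r(1) by (auto simp: Tx divide_strict_right_mono)
  \<comment> \<open>Buffer heights: near \<open>\<xi>\<close> the centres of the
    \<open>r\<close>-balls stay below \<open>\<alpha>\<close> and the graph stays above
    \<open>\<beta>\<close>. Points \<open>y\<close> with height in between meet the hypotheses of
    \<open>strict_local_support\<close> at every \<open>z\<close> in \<open>A\<close>.\<close>
  then obtain \<alpha> \<beta> where \<alpha>\<beta>: "g z\<^sub>0 - r / N\<^sub>0 < \<alpha>" "\<alpha> < T x $ k" "T x $ k < \<beta>" "\<beta> < g z\<^sub>0"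
    using dense by meson
  have "(g \<longlongrightarrow> g z\<^sub>0) (at z\<^sub>0 within H)"
    using continuous_on_g z\<^sub>0(1) by (simp add: continuous_on_def)
  moreover have "((\<lambda>z. g z - r / norm (\<nu> z)) \<longlongrightarrow> g z\<^sub>0 - r / N\<^sub>0) (at z\<^sub>0 within H)"
    using continuous_on_g continuous_on_normal z\<^sub>0(1) unfolding N\<^sub>0_def
    by (intro tendsto_intros) (auto simp: continuous_on_def)
  ultimately have "\<forall>\<^sub>F z in at z\<^sub>0 within H. g z - r / norm (\<nu> z) < \<alpha> \<and> \<beta> < g z"
    using \<alpha>\<beta>(1,4) by (intro eventually_conj order_tendstoD)
  then obtain e\<^sub>1 where e\<^sub>1: "e\<^sub>1 > 0"
    "\<And>z. z \<in> H \<Longrightarrow> dist z z\<^sub>0 < e\<^sub>1 \<Longrightarrow> g z - r / norm (\<nu> z) < \<alpha> \<and> \<beta> < g z"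
    using \<alpha>\<beta>(1,4) unfolding eventually_at N\<^sub>0_def by metis
  obtain e\<^sub>2 where e\<^sub>2: "e\<^sub>2 > 0"
    "\<And>z. z \<in> H \<Longrightarrow> dist z z\<^sub>0 < e\<^sub>2 \<Longrightarrow> inv T (G z) \<in> U \<inter> ball \<xi> s"
    using eventually_inv_T_graph[OF z\<^sub>0(1) open_Int[OF open_U open_ball[of \<xi> s]]] s(1) \<open>\<xi> \<in> U\<close>
    by (auto simp: z\<^sub>0(2))
  define A where "A = H \<inter> ball z\<^sub>0 (min e\<^sub>1 e\<^sub>2)"
  have "convex H" by (auto simp: convex_def coord_hyperplane_def)
  then have "convex A" unfolding A_def by (intro convex_Int convex_ball)
  obtain e\<^sub>3 where e\<^sub>3: "e\<^sub>3 > 0" "ball \<xi> e\<^sub>3 \<subseteq> U"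
    using open_U \<open>\<xi> \<in> U\<close> by (rule openE)
  have "\<exists>\<delta>>0. \<forall>y q. dist y x < \<delta> \<longrightarrow> q \<in> frontier \<Omega> \<longrightarrow> dist q y = infdist y (frontier \<Omega>) \<longrightarrow>
      dist q \<xi> < min e\<^sub>3 (min e\<^sub>1 e\<^sub>2)"
    by (rule closest_points_near[OF frontier_closed closest_point_unique[OF proj]])
      (use e\<^sub>1(1) e\<^sub>2(1) e\<^sub>3(1) in simp_all)
  then obtain \<delta>\<^sub>1 where \<delta>\<^sub>1: "\<delta>\<^sub>1 > 0"
    "\<And>y q. dist y x < \<delta>\<^sub>1 \<Longrightarrow> q \<in> frontier \<Omega> \<Longrightarrow> dist q y = infdist y (frontier \<Omega>) \<Longrightarrow>
      dist q \<xi> < min e\<^sub>3 (min e\<^sub>1 e\<^sub>2)" by blast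
  \<comment> \<open>The first bound keeps the nearest points of \<open>y\<close> over
    \<open>A\<close>, the other two keep the height of \<open>T y\<close> between
    \<open>\<alpha>\<close> and \<open>\<beta>\<close>.\<close>
  define \<delta> where "\<delta> = min \<delta>\<^sub>1 (min (T x $ k - \<alpha>) (\<beta> - T x $ k))"
  have "\<delta> > 0" using \<delta>\<^sub>1(1) \<alpha>\<beta> by (simp add: \<delta>_def)
  have "is_singleton (metric_projection \<Omega> y)" if y: "dist y x < \<delta>" for y
  proof -
    define f where "f w = (dist (G w) (T y))\<^sup>2" for w
    have "\<bar>T y $ k - T x $ k\<bar> < \<delta>"
      using component_le_norm_cart[of "T y - T x" k] y by (simp flip: dist_norm)
    then have Y: "\<alpha> < T y $ k" "T y $ k < \<beta>" by (auto simp: \<delta>_def)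
    have frontierA: "inv T (G z) \<in> U" "inv T (G z) \<in> ball \<xi> s" "inv T (G z) \<in> frontier \<Omega>" if "z \<in> A" for z
      using e\<^sub>2(2)[of z] that inv_T_graph_frontier[of z] by (auto simp: A_def dist_commute)
    have supp: "\<exists>b. \<exists>e>0. \<forall>w\<in>A. dist w z < e \<longrightarrow> w \<noteq> z \<longrightarrow> f z + (w - z) \<bullet> b < f w" if z: "z \<in> A" for z
    proof -
      obtain c where c: "locally_inner_touching_ball \<Omega> (inv T (G z)) c r"
        using touch frontierA z by blast
      have zH: "z \<in> H" "dist z z\<^sub>0 < e\<^sub>1" using z by (auto simp: A_def dist_commute)
      have "T c = G z - (r / norm (\<nu> z)) *\<^sub>R \<nu> z"
        using touching_ball_center[OF frontierA(3,1) c] z zH by (simp add: drop_graph)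
      then have "T c $ k = g z - r / norm (\<nu> z)" using graph_nth[OF zH(1)] by simp
      then have "T c $ k < T y $ k" "T y $ k < g z" using e\<^sub>1(2)[OF zH] Y by auto
      from strict_local_support[OF zH(1) frontierA(1)[OF z] c this]
      show ?thesis unfolding f_def A_def by blast
    qed
    have cont: "continuous_on A f" unfolding f_def A_def
      by (intro continuous_intros continuous_on_subset[OF continuous_on_graph]) auto
    \<comment> \<open>The graph over \<open>A\<close> consists of frontier points, so the base point
      of any nearest point of \<open>y\<close> minimises \<open>f\<close> on
      \<open>A\<close>.\<close>
    have proj_A: "drop_coord k (T q) \<in> A \<and> G (drop_coord k (T q)) = T q \<and> (\<forall>z\<in>A. f (drop_coord k (T q)) \<le> f z)"
      if q: "q \<in> metric_projection \<Omega> y" for q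
    proof (intro conjI ballI)
      have q': "q \<in> frontier \<Omega>" "dist q y = infdist y (frontier \<Omega>)" using q by (auto simp: metric_projection_def)
      have near: "dist q \<xi> < min e\<^sub>3 (min e\<^sub>1 e\<^sub>2)" using \<delta>\<^sub>1(2)[OF _ q'] y by (simp add: \<delta>_def)
      have "q \<in> U" using near e\<^sub>3(2) by (auto simp: dist_commute)
      then show Gq: "G (drop_coord k (T q)) = T q" using graph_drop q'(1) by blast
      have "dist (drop_coord k (T q)) z\<^sub>0 \<le> dist q \<xi>"
        using dist_drop_coord_le[of k "T q" "T \<xi>"] by (simp add: z\<^sub>0_def)
      then show "drop_coord k (T q) \<in> A" using near by (auto simp: A_def dist_commute)
      fix z assume z: "z \<in> A"
      have "dist q y \<le> dist (inv T (G z)) y"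
        using infdist_le[OF frontierA(3)[OF z], of y] q'(2) by (simp add: dist_commute)
      then show "f (drop_coord k (T q)) \<le> f z" unfolding f_def Gq by (simp add: dist_inv_T power_mono)
    qed
    have "q = q'" if "q \<in> metric_projection \<Omega> y" "q' \<in> metric_projection \<Omega> y" for q q'
    proof -
      have "drop_coord k (T q) = drop_coord k (T q')"
        by (rule strict_local_support_unique_minimum[OF \<open>convex A\<close> cont supp])
          (use proj_A[OF that(1)] proj_A[OF that(2)] in auto)
      then have "T q = T q'" using proj_A[OF that(1)] proj_A[OF that(2)] by metis
      then show ?thesis by simp
    qed
    moreover have "metric_projection \<Omega> y \<noteq> {}" using metric_projection_nonempty \<xi>(1) by blast
    ultimately show ?thesis unfolding is_singleton_def by blast
  qed
  then have "\<And>y. y \<in> skeleton \<Omega> \<Longrightarrow> \<not> dist y x < \<delta>" by (auto simp: skeleton_def)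
  then show ?thesis using \<open>\<delta> > 0\<close> by (metis closure_approachable)
qed

section \<open>From local uniqueness to the curvature bound\<close>

lemma infdist_less_inner_radius_lsc:
  assumes x: "x \<in> \<Omega>" and proj: "metric_projection \<Omega> x = {\<xi>}" and "\<xi> \<in> U"
    and skel: "x \<notin> closure (skeleton \<Omega>)"
  shows "ereal (infdist x (frontier \<Omega>)) < inner_radius_lsc \<Omega> \<xi>"
proof -
  have \<xi>: "\<xi> \<in> frontier \<Omega>" using proj by (auto simp: metric_projection_def)
  obtain \<delta>\<^sub>1 where \<delta>\<^sub>1: "\<delta>\<^sub>1 > 0" "ball x \<delta>\<^sub>1 \<subseteq> \<Omega> - closure (skeleton \<Omega>)"
    by (rule openE[of "\<Omega> - closure (skeleton \<Omega>)" x]) (use open_domain x skel in auto)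
  obtain e where e: "e > 0" "ball \<xi> e \<subseteq> U"
    using open_U \<open>\<xi> \<in> U\<close> by (rule openE)
  have "\<exists>\<delta>>0. \<forall>y q. dist y x < \<delta> \<longrightarrow> q \<in> frontier \<Omega> \<longrightarrow> dist q y = infdist y (frontier \<Omega>) \<longrightarrow>
      dist q \<xi> < e"
    by (rule closest_points_near[OF frontier_closed closest_point_unique[OF proj] e(1)])
  then obtain \<delta>\<^sub>2 where \<delta>\<^sub>2: "\<delta>\<^sub>2 > 0"
    "\<And>y q. dist y x < \<delta>\<^sub>2 \<Longrightarrow> q \<in> frontier \<Omega> \<Longrightarrow> dist q y = infdist y (frontier \<Omega>) \<Longrightarrow> dist q \<xi> < e"
    by blast
  \<comment> \<open>On this ball the projection is single-valued and stays in the chart.\<close>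
  define B where "B = ball x (min \<delta>\<^sub>1 \<delta>\<^sub>2)"
  define p where "p y = the_elem (metric_projection \<Omega> y)" for y
  have B\<Omega>: "y \<in> \<Omega>" if "y \<in> B" for y using \<delta>\<^sub>1(2) that by (auto simp: B_def)
  have p: "metric_projection \<Omega> y = {p y}" if "y \<in> B" for y
  proof -
    have "y \<in> \<Omega> - closure (skeleton \<Omega>)" using that \<delta>\<^sub>1(2) by (auto simp: B_def)
    then have "is_singleton (metric_projection \<Omega> y)" using closure_subset[of "skeleton \<Omega>"] unfolding skeleton_def by blast
    then show ?thesis by (simp add: p_def is_singleton_the_elem)
  qed
  have p': "p y \<in> frontier \<Omega>" "dist (p y) y = infdist y (frontier \<Omega>)" if "y \<in> B" for y
  proof -
    have "p y \<in> metric_projection \<Omega> y" using p[OF that] by simp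
    then show "p y \<in> frontier \<Omega>" "dist (p y) y = infdist y (frontier \<Omega>)"
      by (simp_all add: metric_projection_def)
  qed
  have pU: "p y \<in> U" if "y \<in> B" for y
  proof -
    have "dist (p y) \<xi> < e" using \<delta>\<^sub>2(2)[OF _ p'[OF that]] that by (auto simp: B_def dist_commute)
    then show ?thesis using e(2) by (auto simp: dist_commute)
  qed
  have cont_p: "continuous_on B p"
    unfolding continuous_on_iff
  proof (intro ballI allI impI)
    fix y and \<epsilon> :: real assume y: "y \<in> B" and "\<epsilon> > 0"
    from closest_points_near[OF frontier_closed closest_point_unique[OF p[OF y]] \<open>\<epsilon> > 0\<close>]
    show "\<exists>d>0. \<forall>y'\<in>B. dist y' y < d \<longrightarrow> dist (p y') (p y) < \<epsilon>" using p' by metis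
  qed
  \<comment> \<open>The \<open>k\<close>-th coordinate, free in the hyperplane, stores the distance.
    Source and target thus have the same dimension, as invariance of domain requires.\<close>
  define F where "F y = drop_coord k (T (p y)) + infdist y (frontier \<Omega>) *\<^sub>R axis k 1" for y
  have dropF: "drop_coord k (F y) = drop_coord k (T (p y))" "F y $ k = infdist y (frontier \<Omega>)" for y
    by (auto simp: F_def vec_eq_iff axis_def)
  have cont_F: "continuous_on B F" unfolding F_def
    by (intro continuous_intros continuous_on_compose2[OF linear_continuous_on[of "drop_coord k" UNIV]]
        continuous_on_compose2[OF continuous_on_T[of UNIV] cont_p])
      (auto simp: linear_drop_coord linear_conv_bounded_linear[symmetric])
  have same_p: "\<eta> = p y" if "y \<in> B" "\<eta> \<in> frontier \<Omega>" "\<eta> \<in> U" "drop_coord k (T \<eta>) = drop_coord k (F y)" for y \<eta>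
  proof -
    have "T \<eta> = T (p y)"
      using graph_drop[OF that(2,3)] graph_drop[OF p'(1)[OF that(1)] pU[OF that(1)]] that(4) dropF(1) by metis
    then show ?thesis by simp
  qed
  have touch: "locally_inner_touching_ball \<Omega> (p y) y (infdist y (frontier \<Omega>))" if "y \<in> B" for y
    using locally_inner_touching_ball_closest[OF open_domain B\<Omega>] that p by blast
  have inj: "inj_on F B"
  proof (rule inj_onI)
    fix y y' assume y: "y \<in> B" "y' \<in> B" and eq: "F y = F y'"
    have pp: "p y = p y'" using same_p[OF y(2) p'(1)[OF y(1)] pU[OF y(1)]] dropF(1) eq by metis
    have "infdist y (frontier \<Omega>) = infdist y' (frontier \<Omega>)" using dropF(2) eq by metis
    \<comment> \<open>Boundary point and radius determine the centre of a touching ball, and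
      \<open>y\<close> is the centre of the one at \<open>p y\<close>.\<close>
    then have "T y = T y'"
      using touching_ball_center[OF p'(1) pU touch, OF y(1) y(1) y(1)]
        touching_ball_center[OF p'(1) pU touch, OF y(2) y(2) y(2)] by (simp add: pp)
    then show "y = y'" by simp
  qed
  have "open (F ` B)"
    by (rule invariance_of_domain[OF cont_F _ inj]) (simp add: B_def)
  moreover have xB: "x \<in> B" using \<delta>\<^sub>1(1) \<delta>\<^sub>2(1) by (simp add: B_def)
  ultimately obtain \<epsilon> where \<epsilon>: "\<epsilon> > 0" "ball (F x) \<epsilon> \<subseteq> F ` B"
    using openE[of "F ` B" "F x"] by blast
  have px: "p x = \<xi>" using p[OF xB] proj by simp
  define d where "d = infdist x (frontier \<Omega>)"
  have "ereal (d + \<epsilon> / 2) \<le> inner_radius \<Omega> \<eta>" if \<eta>: "\<eta> \<in> ball \<xi> (min e (\<epsilon> / 2)) \<inter> frontier \<Omega>" for \<eta>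
  proof -
    \<comment> \<open>Half of \<open>\<epsilon>\<close> pays for moving the base point, the other
      half for enlarging the radius. A preimage \<open>y\<close> of \<open>v\<close> is the centre
      of a ball of radius \<open>d + \<epsilon> / 2\<close> touching at
      \<open>\<eta>\<close>.\<close>
    define v where "v = drop_coord k (T \<eta>) + (d + \<epsilon> / 2) *\<^sub>R axis k 1"
    have v: "drop_coord k v = drop_coord k (T \<eta>)" "v $ k = d + \<epsilon> / 2"
      by (auto simp: v_def vec_eq_iff axis_def)
    have "v - F x = (drop_coord k (T \<eta>) - drop_coord k (T \<xi>)) + (\<epsilon> / 2) *\<^sub>R axis k 1"
      by (simp add: v_def F_def px d_def algebra_simps)
    then have "norm (v - F x) \<le> dist (drop_coord k (T \<eta>)) (drop_coord k (T \<xi>)) + \<epsilon> / 2"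
      using norm_triangle_ineq[of "drop_coord k (T \<eta>) - drop_coord k (T \<xi>)" "(\<epsilon> / 2) *\<^sub>R axis k 1"] \<epsilon>(1)
      by (simp add: dist_norm)
    also have "\<dots> < \<epsilon>" using dist_drop_coord_le[of k "T \<eta>" "T \<xi>"] \<eta> by (simp add: dist_commute)
    finally have "v \<in> F ` B" using \<epsilon>(2) by (auto simp: dist_norm norm_minus_commute)
    then obtain y where y: "y \<in> B" "v = F y" by auto
    have "\<eta> = p y" by (rule same_p) (use y v \<eta> e(2) in auto)
    moreover have "infdist y (frontier \<Omega>) = d + \<epsilon> / 2" using v(2) y(2) dropF(2) by simp
    ultimately show ?thesis using inner_radius_ge[OF touch[OF y(1)]] by simp
  qed
  then have "ereal (d + \<epsilon> / 2) \<le> (INF \<eta>\<in>ball \<xi> (min e (\<epsilon> / 2)) \<inter> frontier \<Omega>. inner_radius \<Omega> \<eta>)"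
    by (rule INF_greatest)
  also have "\<dots> \<le> inner_radius_lsc \<Omega> \<xi>"
    unfolding inner_radius_lsc_eq by (rule SUP_upper) (use e(1) \<epsilon>(1) in simp)
  finally have "ereal (d + \<epsilon> / 2) \<le> inner_radius_lsc \<Omega> \<xi>" .
  moreover have "ereal d < ereal (d + \<epsilon> / 2)" using \<epsilon>(1) by simp
  ultimately show ?thesis unfolding d_def[symmetric] by (rule order.strict_trans2[rotated])
qed

end

theorem theorem1p3:
  fixes \<Omega> :: "(real^'n) set" and x :: "real^'n"
  assumes "CARD('n) \<ge> 2"
    and "open \<Omega>"
    and "frontier \<Omega> \<noteq> {}"
    and "C1_boundary \<Omega>"
    and "x \<in> \<Omega>"
  shows "x \<in> \<Omega> - cut_locus \<Omega> \<longleftrightarrow>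
    (\<exists>\<xi>. metric_projection \<Omega> x = {\<xi>} \<and>
         ereal (infdist x (frontier \<Omega>)) < inner_radius_lsc \<Omega> \<xi>)"
proof -
  \<comment> \<open>Once the projection is a single point \<open>\<xi>\<close>, both directions are
    local and take place in one chart around \<open>\<xi>\<close>.\<close>
  have lsc: "ereal (infdist x (frontier \<Omega>)) < inner_radius_lsc \<Omega> \<xi> \<longleftrightarrow> x \<notin> closure (skeleton \<Omega>)"
    if proj: "metric_projection \<Omega> x = {\<xi>}" for \<xi>
  proof -
    have "\<xi> \<in> frontier \<Omega>" using proj by (auto simp: metric_projection_def)
    from bspec[OF assms(4)[unfolded C1_boundary_def] this] obtain U T k g where U:
      "open U" "\<xi> \<in> U" "rigid_motion T" "C1_on_hyperplane k g"
      "\<Omega> \<inter> U = {y \<in> U. T y $ k < g (drop_coord k (T y))}"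
      "frontier \<Omega> \<inter> U = {y \<in> U. T y $ k = g (drop_coord k (T y))}"
      by (elim exE conjE)
    obtain g' where "C1_graph_chart \<Omega> U T k g g'"
      using U assms(2) unfolding C1_on_hyperplane_def C1_graph_chart_def by auto
    then interpret C1_graph_chart \<Omega> U T k g g' .
    show ?thesis
      using not_in_closure_skeleton infdist_less_inner_radius_lsc assms(5) proj U(2) by blast
  qed
  have "\<exists>\<xi>. metric_projection \<Omega> x = {\<xi>}" if "x \<notin> closure (skeleton \<Omega>)"
  proof -
    have "x \<notin> skeleton \<Omega>" using that closure_subset[of "skeleton \<Omega>"] by blast
    then show ?thesis using assms(5) by (simp add: skeleton_def is_singleton_def)
  qed
  then show ?thesis using lsc assms(5) unfolding cut_locus_def by blast
qed

end
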